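(* Let $\Phi:T\times\mathbb{R}^n\rightrightarrows\mathbb{R}^m$ be a set-valued normal integrand on a complete finite measure space $(T,\mathcal{A},\mu)$, and let $\bar x\in\operatorname{dom}E_\Phi$. Suppose that there exist $\rho>0$ and $\kappa\in L^1(T,\mathbb{R}_+)$ such that $\Phi_t(x)$ is convex for all $x\in\mathbb{B}_\rho(\bar x)$ and a.e. $t\in T_{na}$, and $\Phi_t(x)\subset\kappa(t)\mathbb{B}$ for all $x\in\mathbb{B}_\rho(\bar x)$ and a.e. $t\in T$. Take $\bar y\in E_\Phi(\bar x)$ such that the mapping $\mathcal{S}_\Phi$ is inner semicompact at $(\bar x,\bar y)$, and assume that $\Phi$ is integrably quasi-Lipschitzian around $(\bar x,\bar{\mathsf y})$ for all $\bar{\mathsf y}\in\mathcal{S}_\Phi(\bar x,\bar y)$. Assume in addition that $$\int_T D^*\Phi_t(\bar x,\bar{\mathsf y}(t))(0)\,d\mu=\{0\}\quad\text{for all }\bar{\mathsf y}\in\mathcal{S}_\Phi(\bar x,\bar y).$$ Then the expected-integral multifunction $E_\Phi$ is Lipschitz-like around $(\bar x,\bar y)$.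
   Context: $\mathbb{R}_+:=\{\alpha\in\mathbb{R}:\alpha>0\}$; $L^p(T,\cdot)$ are the usual Lebesgue spaces; vectors are identified with constant functions; $\mathbb{B}_r(\cdot)$ is the closed ball, $\mathbb{B}$ the closed unit ball. $T=T_{pa}\cup T_{na}$ is the disjoint measurable decomposition of $T$ such that $\mu(\cdot\cap T_{pa})$ is purely atomic and $\mu(\cdot\cap T_{na})$ is nonatomic. For $\Phi:T\times\mathbb{R}^n\rightrightarrows\mathbb{R}^m$ write $\Phi_t:=\Phi(t,\cdot)$. $\Phi$ is a set-valued normal integrand if $\operatorname{gph}\Phi_t$ is closed for all $t\in T$ and $\operatorname{gph}\Phi\in\mathcal{A}\otimes\mathcal{B}(\mathbb{R}^n\times\mathbb{R}^m)$. The (Aumann) integral of $F:T\rightrightarrows\mathbb{R}^d$ is $\int_TF(t)d\mu=\{\int_T\mathsf{v}\,d\mu:\mathsf{v}\in L^1(T,\mathbb{R}^d),\ \mathsf{v}(t)\in F(t)\text{ a.e.}\}$. $E_\Phi(x):=\int_T\Phi_t(x)d\mu$. $\mathcal{S}_\Phi(x,y):=\{\mathsf{y}\in L^1(T,\mathbb{R}^m):\int_T\mathsf{y}\,d\mu=y,\ \mathsf{y}(t)\in\Phi_t(x)\text{ for a.e. }t\}$. $\mathcal{S}_\Phi$ is inner semicompact at $(\bar x,\bar y)$ if for every sequence $(x_k,y_k)\to(\bar x,\bar y)$ with $\mathcal{S}_\Phi(x_k,y_k)\neq\emptyset$ there is a sequence $\mathsf{y}_k\in\mathcal{S}_\Phi(x_k,y_k)$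 containing an $L^1(T,\mathbb{R}^m)$-norm convergent subsequence. A multifunction $G:\mathbb{R}^n\rightrightarrows\mathbb{R}^m$ is Lipschitz-like around $(\bar x,\bar y)\in\operatorname{gph}G$ if there exist $\eta>0$, $\ell\ge0$ with $G(x)\cap\mathbb{B}_\eta(\bar y)\subset G(x')+\ell\|x-x'\|\mathbb{B}$ for all $x,x'\in\mathbb{B}_\eta(\bar x)$. Regular normal cone: $\hat N(\bar z;\Omega)=\{z^*:\limsup_{z\to\bar z,z\in\Omega}\langle z^*,z-\bar z\rangle/\|z-\bar z\|\le0\}$ for $\bar z\in\Omega$, $\emptyset$ otherwise. Limiting normal cone: $N(\bar z;\Omega)=\{z^*:\exists z_k\to\bar z,\ z_k^*\to z^*,\ z_k^*\in\hat N(z_k;\Omega)\}$. Limiting coderivative at $(x,y)\in\operatorname{gph}G$: $D^*G(x,y)(y^* )=\{x^*:(x^*,-y^* )\in N((x,y);\operatorname{gph}G)\}$. $\Phi$ is integrably quasi-Lipschitzian around $(\bar x,\bar{\mathsf y})$ if there exist $\eta>0$ and $\ell\in L^1(T,\mathbb{R}_+)$ such that $\sup\{\|x^*\|:x^*\in D^*\Phi_t(\mathsf{x}(t),\mathsf{y}(t))(\mathsf{y}^*(t))\}\le\ell(t)\|\mathsf{y}^*(t)\|$ for a.e. $t\in T$ whenever $\mathsf{x}\in L^\infty(T,\mathbb{R}^n)$ with $\|\mathsf{x}-\bar x\|_\infty\le\eta$, $\mathsf{y}\in L^1(T,\mathbb{R}^m)$ with $\|\mathsf{y}-\bar{\mathsf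 y}\|_1\le\eta$ and $\mathsf{y}(t)\in\Phi_t(\mathsf{x}(t))$ a.e., and $\mathsf{y}^*\in L^\infty(T,\mathbb{R}^m)$ (the inequality being regarded as satisfied when the set is empty). *)

theory Defs
  imports "HOL-Analysis.Analysis" "HOL-Probability.Essential_Supremum"
begin

section \<open>Atoms\<close>

definition measure_atom :: "'a measure \<Rightarrow> 'a set \<Rightarrow> bool" where
  "measure_atom M A \<longleftrightarrow> A \<in> sets M \<and> emeasure M A > 0 \<and>
     (\<forall>B\<in>sets M. B \<subseteq> A \<longrightarrow> emeasure M B = 0 \<or> emeasure M (A - B) = 0)"

definition purely_atomic :: "'a measure \<Rightarrow> bool" where
  "purely_atomic M \<longleftrightarrow>
     (\<forall>A\<in>sets M. emeasure M A > 0 \<longrightarrow> (\<exists>B\<subseteq>A. measure_atom M B))"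

definition nonatomic :: "'a measure \<Rightarrow> bool" where
  "nonatomic M \<longleftrightarrow> (\<nexists>A. measure_atom M A)"

text \<open>\<open>density M (indicator S)\<close> is the measure \<open>A \<mapsto> \<mu> (A \<inter> S)\<close> on the same \<open>\<sigma>\<close>-algebra.\<close>

definition atomic_decomposition :: "'a measure \<Rightarrow> 'a set \<Rightarrow> 'a set \<Rightarrow> bool" where
  "atomic_decomposition M Tpa Tna \<longleftrightarrow>
     Tpa \<in> sets M \<and> Tna \<in> sets M \<and> Tpa \<union> Tna = space M \<and> Tpa \<inter> Tna = {} \<and>
     purely_atomic (density M (indicator Tpa)) \<and> nonatomic (density M (indicator Tna))"

section \<open>Lebesgue spaces\<close>

text \<open>Elements of Lebesgue spaces are represented by functions, not by equivalence classes;
  accordingly every pointwise condition on them is imposed almost everywhere.\<close>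

definition in_L1_pos :: "'a measure \<Rightarrow> ('a \<Rightarrow> real) \<Rightarrow> bool" where
  "in_L1_pos M k \<longleftrightarrow> integrable M k \<and> (AE t in M. k t > 0)"

definition L1_norm :: "'a measure \<Rightarrow> ('a \<Rightarrow> 'b::euclidean_space) \<Rightarrow> real" where
  "L1_norm M f = (\<integral>t. norm (f t) \<partial>M)"

definition Linf_norm :: "'a measure \<Rightarrow> ('a \<Rightarrow> 'b::euclidean_space) \<Rightarrow> ereal" where
  "Linf_norm M f = esssup M (\<lambda>t. ereal (norm (f t)))"

definition in_Linf :: "'a measure \<Rightarrow> ('a \<Rightarrow> 'b::euclidean_space) \<Rightarrow> bool" where
  "in_Linf M f \<longleftrightarrow> f \<in> borel_measurable M \<and> Linf_norm M f < \<infinity>"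

section \<open>Multifunctions and generalized differentiation\<close>

definition gph :: "('x \<Rightarrow> 'y set) \<Rightarrow> ('x \<times> 'y) set" where
  "gph G = {(x, y). y \<in> G x}"

definition mdom :: "('x \<Rightarrow> 'y set) \<Rightarrow> 'x set" where
  "mdom G = {x. G x \<noteq> {}}"

text \<open>The filter \<open>at z within \<Omega>\<close> excludes \<open>z\<close> itself. At an isolated point of \<open>\<Omega>\<close> the
  limsup is therefore \<open>-\<infinity>\<close> and the cone is the whole space.\<close>

definition regular_normal_cone :: "'z::euclidean_space \<Rightarrow> 'z set \<Rightarrow> 'z set" where
  "regular_normal_cone z \<Omega> =
     (if z \<in> \<Omega>
      then {zs. Limsup (at z within \<Omega>) (\<lambda>w. ereal (inner zs (w - z) / norm (w - z))) \<le> 0}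
      else {})"

definition limiting_normal_cone :: "'z::euclidean_space \<Rightarrow> 'z set \<Rightarrow> 'z set" where
  "limiting_normal_cone z \<Omega> =
     {zs. \<exists>w ws. w \<longlonglongrightarrow> z \<and> ws \<longlonglongrightarrow> zs \<and> (\<forall>k. ws k \<in> regular_normal_cone (w k) \<Omega>)}"

definition coderivative ::
  "('x::euclidean_space \<Rightarrow> 'y::euclidean_space set) \<Rightarrow> 'x \<Rightarrow> 'y \<Rightarrow> 'y \<Rightarrow> 'x set" where
  "coderivative G x y ys = {xs. (xs, - ys) \<in> limiting_normal_cone (x, y) (gph G)}"

definition lipschitz_like ::
  "('x::euclidean_space \<Rightarrow> 'y::euclidean_space set) \<Rightarrow> 'x \<Rightarrow> 'y \<Rightarrow> bool" where
  "lipschitz_like G xbar ybar \<longleftrightarrow> (xbar, ybar) \<in> gph G \<and>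
     (\<exists>\<eta>>0. \<exists>l\<ge>0. \<forall>x\<in>cball xbar \<eta>. \<forall>x'\<in>cball xbar \<eta>.
        G x \<inter> cball ybar \<eta> \<subseteq>
          {y' + (l * norm (x - x')) *\<^sub>R b | y' b. y' \<in> G x' \<and> b \<in> cball 0 1})"

section \<open>Expected-integral multifunctions\<close>

definition normal_integrand ::
  "'a measure \<Rightarrow> ('a \<Rightarrow> 'x::euclidean_space \<Rightarrow> 'y::euclidean_space set) \<Rightarrow> bool" where
  "normal_integrand M \<Phi> \<longleftrightarrow>
     (\<forall>t\<in>space M. closed (gph (\<Phi> t))) \<and>
     {(t, z). t \<in> space M \<and> z \<in> gph (\<Phi> t)} \<in> sets (M \<Otimes>\<^sub>M (borel :: ('x \<times> 'y) measure))"

definition aumann_integral :: "'a measure \<Rightarrow> ('a \<Rightarrow> 'b::euclidean_space set) \<Rightarrow> 'b set" where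
  "aumann_integral M F =
     {(\<integral>t. v t \<partial>M) | v. integrable M v \<and> (AE t in M. v t \<in> F t)}"

definition expected_integral ::
  "'a measure \<Rightarrow> ('a \<Rightarrow> 'x \<Rightarrow> 'y::euclidean_space set) \<Rightarrow> 'x \<Rightarrow> 'y set" where
  "expected_integral M \<Phi> x = aumann_integral M (\<lambda>t. \<Phi> t x)"

definition selections ::
  "'a measure \<Rightarrow> ('a \<Rightarrow> 'x \<Rightarrow> 'y::euclidean_space set) \<Rightarrow> 'x \<Rightarrow> 'y \<Rightarrow> ('a \<Rightarrow> 'y) set" where
  "selections M \<Phi> x y =
     {v. integrable M v \<and> (\<integral>t. v t \<partial>M) = y \<and> (AE t in M. v t \<in> \<Phi> t x)}"

definition selections_inner_semicompact ::
  "'a measure \<Rightarrow> ('a \<Rightarrow> 'x::euclidean_space \<Rightarrow> 'y::euclidean_space set) \<Rightarrow> 'x \<Rightarrow> 'y \<Rightarrow> bool" where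
  "selections_inner_semicompact M \<Phi> xbar ybar \<longleftrightarrow>
     (\<forall>x y. (\<lambda>k. (x k, y k)) \<longlonglongrightarrow> (xbar, ybar) \<longrightarrow>
        (\<forall>k::nat. selections M \<Phi> (x k) (y k) \<noteq> {}) \<longrightarrow>
        (\<exists>v. (\<forall>k. v k \<in> selections M \<Phi> (x k) (y k)) \<and>
          (\<exists>r u. strict_mono (r :: nat \<Rightarrow> nat) \<and> integrable M u \<and>
             (\<lambda>j. L1_norm M (\<lambda>t. v (r j) t - u t)) \<longlonglongrightarrow> 0)))"

text \<open>The supremum is taken in \<^typ>\<open>ereal\<close>, so it is \<open>-\<infinity>\<close> over the empty set, and the
  inequality is then satisfied.\<close>

definition integrably_quasi_lipschitzian ::
  "'a measure \<Rightarrow> ('a \<Rightarrow> 'x::euclidean_space \<Rightarrow> 'y::euclidean_space set) \<Rightarrow>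
     'x \<Rightarrow> ('a \<Rightarrow> 'y) \<Rightarrow> bool" where
  "integrably_quasi_lipschitzian M \<Phi> xbar ybar \<longleftrightarrow>
     (\<exists>\<eta>>0. \<exists>l. in_L1_pos M l \<and>
       (\<forall>x y ys.
          in_Linf M x \<and> Linf_norm M (\<lambda>t. x t - xbar) \<le> ereal \<eta> \<and>
          integrable M y \<and> L1_norm M (\<lambda>t. y t - ybar t) \<le> \<eta> \<and>
          (AE t in M. y t \<in> \<Phi> t (x t)) \<and> in_Linf M ys \<longrightarrow>
          (AE t in M. (SUP xs\<in>coderivative (\<Phi> t) (x t) (y t) (ys t). ereal (norm xs))
             \<le> ereal (l t * norm (ys t)))))"

end

(* The contradiction comes from a single choice of test functions. Let u be a selection of Phi(x0)
   that is L1-close to a selection w of Phi(xbar), and let x1 be another point near xbar, at distance d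
   from x0. For each t, minimize the penalty |x - x1| + sqrt(|y - u(t)|^2 + d^2) / (|l(t)| + 1) over
   the graph of Phi_t. The minimizer stays within d (|l(t)| + 2) of u(t), hence is L1-close to w, so
   the quasi-Lipschitz bound applies to it. At a minimizer with x different from x1 the negative
   gradient would be a regular normal violating this bound, so x = x1, and the minimizers
   form a selection of Phi(x1) at L1-distance O(d) from u. Inner semicompactness supplies the
   required L1-convergence along a sequence violating the Lipschitz-like property. A measurable
   choice of minimizers rests on the measurable projection theorem. *)

theory Submission
  imports Defs
begin

section \<open>Measurable projection\<close>

text \<open>This is continuity from the Baire space into a discrete space; the length of the
  deciding prefix may depend on the point.\<close>

definition locally_constant :: "((nat \<Rightarrow> nat) \<Rightarrow> 'c) \<Rightarrow> bool" where
  "locally_constant f \<longleftrightarrow> (\<forall>z. \<exists>N. \<forall>z'. (\<forall>i<N. z' i = z i) \<longrightarrow> f z' = f z)"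

text \<open>The scheme is indexed by infinite sequences with locally constant dependence, rather than by
  finite sequences: countable unions and intersections then only re-index the sequence.\<close>

definition souslin_scheme ::
  "'a measure \<Rightarrow> (nat \<Rightarrow> (nat \<Rightarrow> nat) \<Rightarrow> 'a set \<times> 'b::euclidean_space set) \<Rightarrow> bool" where
  "souslin_scheme M P \<longleftrightarrow>
     (\<forall>n z. fst (P n z) \<in> sets M \<and> compact (snd (P n z))) \<and> (\<forall>n. locally_constant (P n))"

definition souslin_set :: "(nat \<Rightarrow> (nat \<Rightarrow> nat) \<Rightarrow> 'a set \<times> 'b set) \<Rightarrow> ('a \<times> 'b) set" where
  "souslin_set P = {w. \<exists>z. \<forall>n. fst w \<in> fst (P n z) \<and> snd w \<in> snd (P n z)}"

definition souslin :: "'a measure \<Rightarrow> ('a \<times> 'b::euclidean_space) set \<Rightarrow> bool" where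
  "souslin M E \<longleftrightarrow> (\<exists>P. souslin_scheme M P \<and> E = souslin_set P)"

section \<open>Closure properties of Souslin sets\<close>

lemma souslin_Times_compact:
  assumes "A \<in> sets M" "compact K"
  shows "souslin M (A \<times> K)"
  unfolding souslin_def
  by (rule exI[of _ "\<lambda>n z. (A, K)"]) (use assms in \<open>auto simp: souslin_scheme_def souslin_set_def locally_constant_def\<close>)

text \<open>The head of the branch names the member of the union, and its tail serves as the branch
  for that member.\<close>

lemma souslin_UN:
  fixes E :: "nat \<Rightarrow> ('a \<times> 'b::euclidean_space) set"
  assumes "\<And>i. souslin M (E i)"
  shows "souslin M (\<Union>i. E i)"
proof -
  from assms obtain P where P: "\<And>i. souslin_scheme M (P i)" "\<And>i. E i = souslin_set (P i)"
    unfolding souslin_def by metis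
  define Q where "Q n z = P (z 0) n (\<lambda>j. z (Suc j))" for n z
  have "locally_constant (Q n)" for n
    unfolding locally_constant_def
  proof
    fix z
    obtain N where N: "\<And>z'. (\<forall>i<N. z' i = z (Suc i)) \<Longrightarrow> P (z 0) n z' = P (z 0) n (\<lambda>j. z (Suc j))"
      using P(1)[of "z 0"] unfolding souslin_scheme_def locally_constant_def by meson
    show "\<exists>N. \<forall>z'. (\<forall>i<N. z' i = z i) \<longrightarrow> Q n z' = Q n z"
    proof (intro exI allI impI)
      fix z' :: "nat \<Rightarrow> nat" assume "\<forall>i<Suc N. z' i = z i"
      then show "Q n z' = Q n z"
        using N[of "\<lambda>j. z' (Suc j)"] by (auto simp: Q_def)
    qed
  qed
  moreover have "(\<Union>i. E i) = souslin_set Q"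
  proof (intro set_eqI iffI)
    fix w assume "w \<in> (\<Union>i. E i)"
    then obtain i z where "\<forall>n. fst w \<in> fst (P i n z) \<and> snd w \<in> snd (P i n z)"
      by (auto simp: P(2) souslin_set_def)
    then have "\<forall>n. fst w \<in> fst (Q n (case_nat i z)) \<and> snd w \<in> snd (Q n (case_nat i z))"
      by (auto simp: Q_def)
    then show "w \<in> souslin_set Q"
      by (auto simp: souslin_set_def)
  qed (auto simp: P(2) souslin_set_def Q_def)
  ultimately show ?thesis
    unfolding souslin_def souslin_scheme_def using P(1)[unfolded souslin_scheme_def]
    by (intro exI[of _ Q]) (auto simp: Q_def)
qed

text \<open>One branch carries countably many: position \<open>prod_encode (i, j)\<close> holds
  entry \<open>j\<close> of the branch for \<open>E i\<close>, and the rectangles are re-indexed by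
  the same pairing.\<close>

lemma souslin_INT:
  fixes E :: "nat \<Rightarrow> ('a \<times> 'b::euclidean_space) set"
  assumes "\<And>i. souslin M (E i)"
  shows "souslin M (\<Inter>i. E i)"
proof -
  from assms obtain P where P: "\<And>i. souslin_scheme M (P i)" "\<And>i. E i = souslin_set (P i)"
    unfolding souslin_def by metis
  define Q where "Q n z = (case prod_decode n of (i, k) \<Rightarrow> P i k (\<lambda>j. z (prod_encode (i, j))))" for n z
  have Q: "Q (prod_encode (i, k)) z = P i k (\<lambda>j. z (prod_encode (i, j)))" for i k z
    by (simp add: Q_def)
  have "locally_constant (Q n)" for n
    unfolding locally_constant_def
  proof
    fix z
    obtain i k where ik: "n = prod_encode (i, k)" by (metis prod_decode_inverse surj_pair)
    obtain N where N: "\<And>z'. (\<forall>j<N. z' j = z (prod_encode (i, j)))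
        \<Longrightarrow> P i k z' = P i k (\<lambda>j. z (prod_encode (i, j)))"
      using P(1)[of i] unfolding souslin_scheme_def locally_constant_def by meson
    \<comment> \<open>A prefix of length \<open>N'\<close> covers the encoded positions of the first
      \<open>N\<close> entries of subsequence \<open>i\<close>; with \<open>{..N}\<close> the
      maximum is never over the empty set.\<close>
    define N' where "N' = Suc (Max ((\<lambda>j. prod_encode (i, j)) ` {..N}))"
    have N': "prod_encode (i, j) < N'" if "j < N" for j
      using that unfolding N'_def less_Suc_eq_le by (intro Max_ge) auto
    show "\<exists>N. \<forall>z'. (\<forall>i<N. z' i = z i) \<longrightarrow> Q n z' = Q n z"
      by (rule exI[of _ N']) (auto simp: ik Q N' intro!: N)
  qed
  moreover have "(\<Inter>i. E i) = souslin_set Q"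
  proof (intro set_eqI iffI)
    fix w assume "w \<in> (\<Inter>i. E i)"
    then have "\<forall>i. \<exists>z. \<forall>n. fst w \<in> fst (P i n z) \<and> snd w \<in> snd (P i n z)"
      by (auto simp: P(2) souslin_set_def)
    then obtain Z where Z: "\<And>i n. fst w \<in> fst (P i n (Z i)) \<and> snd w \<in> snd (P i n (Z i))"
      by metis
    define z where "z m = (case prod_decode m of (i, j) \<Rightarrow> Z i j)" for m
    have "fst w \<in> fst (Q n z) \<and> snd w \<in> snd (Q n z)" for n
      using Z by (cases "prod_decode n") (auto simp: Q_def z_def)
    then show "w \<in> souslin_set Q"
      by (auto simp: souslin_set_def)
  next
    fix w assume "w \<in> souslin_set Q"
    then obtain z where z: "\<And>n. fst w \<in> fst (Q n z) \<and> snd w \<in> snd (Q n z)"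
      by (auto simp: souslin_set_def)
    show "w \<in> (\<Inter>i. E i)"
      using z[of "prod_encode (i, k)" for i k] by (auto simp: P(2) souslin_set_def Q)
  qed
  ultimately show ?thesis
    unfolding souslin_def souslin_scheme_def using P(1)[unfolded souslin_scheme_def]
    by (intro exI[of _ Q]) (auto simp: Q_def split: prod.split)
qed

lemma souslin_Un:
  assumes "souslin M A" "souslin M B"
  shows "souslin M (A \<union> B)"
proof -
  have "A \<union> B = (\<Union>i. case_nat A (\<lambda>_. B) i)" by (subst UNIV_nat_eq) simp
  moreover have "souslin M (case_nat A (\<lambda>_. B) i)" for i using assms by (cases i) auto
  ultimately show ?thesis using souslin_UN by metis
qed

lemma souslin_Int:
  assumes "souslin M A" "souslin M B"
  shows "souslin M (A \<inter> B)"
proof -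
  have "A \<inter> B = (\<Inter>i. case_nat A (\<lambda>_. B) i)" by (subst UNIV_nat_eq) simp
  moreover have "souslin M (case_nat A (\<lambda>_. B) i)" for i using assms by (cases i) auto
  ultimately show ?thesis using souslin_INT by metis
qed

lemma souslin_Times_closed:
  fixes F :: "'b::euclidean_space set"
  assumes "A \<in> sets M" "closed F"
  shows "souslin M (A \<times> F)"
proof -
  have "A \<times> F = (\<Union>n. A \<times> (F \<inter> cball 0 (real n)))"
    using real_arch_simple by (auto simp: dist_norm)
  moreover have "souslin M (A \<times> (F \<inter> cball 0 (real n)))" for n
    using assms by (intro souslin_Times_compact) auto
  ultimately show ?thesis using souslin_UN by metis
qed

lemma souslin_Times_open:
  fixes U :: "'b::euclidean_space set"
  assumes "A \<in> sets M" "open U"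
  shows "souslin M (A \<times> U)"
proof (cases "U = {}")
  case True
  then show ?thesis using souslin_Times_compact[of A M "{}"] assms by simp
next
  case False
  obtain D where D: "countable D" "\<And>X. X \<in> D \<Longrightarrow> \<exists>a b. X = cbox a b" "\<Union>D = U"
    using open_countable_Union_open_cbox[OF assms(2)] by metis
  have ne: "D \<noteq> {}" using D(3) False by auto
  have "A \<times> U = (\<Union>n. A \<times> from_nat_into D n)"
    using D range_from_nat_into[OF ne D(1)] by blast
  moreover have "compact (from_nat_into D n)" for n
    using D(2)[OF from_nat_into[OF ne]] compact_cbox by metis
  then have "souslin M (A \<times> from_nat_into D n)" for n
    using assms(1) by (intro souslin_Times_compact)
  ultimately show ?thesis using souslin_UN by metis
qed

text \<open>Souslin sets need not be closed under complement, so the induction over the generated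
  sigma-algebra carries each set together with its complement.\<close>

lemma souslin_pair_measure:
  fixes E :: "('a \<times> 'b::euclidean_space) set"
  assumes "E \<in> sets (M \<Otimes>\<^sub>M borel)"
  shows "souslin M E"
proof -
  let ?D = "\<lambda>E. souslin M E \<and> souslin M (space M \<times> (UNIV :: 'b set) - E)"
  have compl: "?D (space M \<times> UNIV - E)" if "?D E" "E \<subseteq> space M \<times> UNIV" for E
    using that by (simp add: double_diff)
  have UN: "?D (\<Union>i::nat. E i)" if "\<And>i. ?D (E i)" for E
    using that souslin_UN[of M E] souslin_INT[of M "\<lambda>i. space M \<times> UNIV - E i"] by simp
  have left: "?D (a \<times> UNIV)" if "a \<in> sets M" for a
  proof -
    have "space M \<times> (UNIV :: 'b set) - a \<times> UNIV = (space M - a) \<times> UNIV" by auto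
    with that show ?thesis by (auto intro!: souslin_Times_closed)
  qed
  have empty: "?D {}"
    using left[of "{}"] by simp
  have right: "?D (space M \<times> b)" if "b \<in> sets borel" for b :: "'b set"
  proof -
    from that have "b \<in> sigma_sets UNIV (Collect open)" by (simp add: borel_def)
    then show ?thesis
    proof induct
      case (Basic a)
      have "space M \<times> UNIV - space M \<times> a = space M \<times> (- a)" by auto
      with Basic show ?case by (simp add: souslin_Times_closed souslin_Times_open closed_Compl)
    next
      case Empty
      then show ?case using empty by simp
    next
      case (Compl a)
      have "space M \<times> (UNIV - a) = space M \<times> UNIV - space M \<times> a" by auto
      with compl[OF Compl(2)] show ?case by auto
    next
      case (Union a)
      have "space M \<times> (\<Union>i. a i) = (\<Union>i. space M \<times> a i)" by auto
      with UN[of "\<lambda>i. space M \<times> a i"] Union(2) show ?case by simp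
    qed
  qed
  have rect: "?D (a \<times> b)" if "a \<in> sets M" "b \<in> sets borel" for a and b :: "'b set"
  proof -
    have 1: "a \<times> b = (a \<times> UNIV) \<inter> (space M \<times> b)"
      using sets.sets_into_space[OF that(1)] by auto
    show ?thesis
      unfolding 1 Diff_Int
      using left[OF that(1)] right[OF that(2)] by (auto intro: souslin_Int souslin_Un)
  qed
  have "E \<in> sigma_sets (space M \<times> UNIV) {a \<times> b | a b. a \<in> sets M \<and> b \<in> sets (borel :: 'b measure)}"
    using assms by (simp add: sets_pair_measure)
  \<comment> \<open>The inclusion is carried along because a double complement returns
    \<open>E\<close> only inside \<open>space M \<times> UNIV\<close>.\<close>
  then have "?D E \<and> E \<subseteq> space M \<times> UNIV"
  proof induct
    case (Basic a)
    then obtain a1 a2 where "a = a1 \<times> a2" "a1 \<in> sets M" "a2 \<in> sets (borel :: 'b measure)" by auto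
    with rect[of a1 a2] sets.sets_into_space[of a1 M] show ?case by auto
  next
    case Empty
    then show ?case using empty by simp
  next
    case (Compl a)
    then show ?case using compl by blast
  next
    case (Union a)
    then show ?case using UN[of a] by blast
  qed
  then show ?thesis by simp
qed

section \<open>Measurable hulls and the projection theorem\<close>

lemma measurable_hull_subset:
  assumes "finite_measure M" "S \<subseteq> G" "G \<in> sets M"
  obtains H where "H \<in> sets M" "S \<subseteq> H" "H \<subseteq> G"
    "\<And>F. F \<in> sets M \<Longrightarrow> F \<subseteq> H - S \<Longrightarrow> F \<in> null_sets M"
proof -
  interpret finite_measure M by fact
  \<comment> \<open>The constant cover by \<open>G\<close> will do, as the measure is finite. That
    the envelope exceeds \<open>S\<close> by no measurable set of positive measure stands in for
    measurability of \<open>S\<close>.\<close>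
  have "\<exists>E\<subseteq>(\<Union>n::nat. G). measurable_envelope M S E"
    using assms by (intro measurable_envelopeI_countable_cover) (auto simp: less_top[symmetric])
  then obtain H where "H \<subseteq> G" and H: "measurable_envelope M S H" by auto
  with measurable_envelopeD[OF H] measurable_envelopeD1[OF H] show ?thesis
    by (intro that[of H]) (auto simp: null_sets_def)
qed

text \<open>Marczewski's argument: the hulls of the partial projections over the cylinders form a scheme
  whose branches fail only on a null set, and along a branch compactness of the sections
  produces a point of the set.\<close>

theorem measurable_projection:
  fixes E :: "('a \<times> 'b::euclidean_space) set"
  assumes fin: "finite_measure M" and compl: "complete_measure M" and E: "E \<in> sets (M \<Otimes>\<^sub>M borel)"
  shows "fst ` E \<in> sets M"
proof -
  interpret finite_measure M by fact
  interpret complete_measure M by fact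
  obtain P :: "nat \<Rightarrow> (nat \<Rightarrow> nat) \<Rightarrow> 'a set \<times> 'b set"
    where P: "\<And>n z. fst (P n z) \<in> sets M" "\<And>n z. compact (snd (P n z))"
      "\<And>n. locally_constant (P n)"
      and EP: "E = souslin_set P"
    using souslin_pair_measure[OF E] unfolding souslin_def souslin_scheme_def by metis
  \<comment> \<open>\<open>cyl s\<close> holds the branches beginning with \<open>s\<close>, and
    \<open>S s\<close> is the part of the projection reached through them; \<open>S []\<close> is
    the whole projection.\<close>
  define cyl where "cyl s = {z :: nat \<Rightarrow> nat. map z [0..<length s] = s}" for s
  define S where "S s = {t. \<exists>x. \<exists>z\<in>cyl s. \<forall>n. t \<in> fst (P n z) \<and> x \<in> snd (P n z)}" for s
  \<comment> \<open>\<open>D s\<close> collects indices whose rectangle is decided by the prefix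
    \<open>s\<close>; the cutoff \<open>n < length s\<close> keeps it finite. The branch
    \<open>e s\<close> pads \<open>s\<close> with zeros, only to read off the decided
    rectangles.\<close>
  define D where "D s = {n. n < length s \<and> (\<forall>z\<in>cyl s. \<forall>z'\<in>cyl s. P n z = P n z')}" for s
  define e where "e s = (\<lambda>i. if i < length s then s ! i else (0::nat))" for s
  have e: "e s \<in> cyl s" for s
    by (auto simp: e_def cyl_def intro!: nth_equalityI)
  \<comment> \<open>\<open>G s\<close> is what the decided rectangles alone can test. Its first
    condition does not involve \<open>t\<close>, so \<open>G s\<close> is empty or a finite
    intersection of measurable sets.\<close>
  define G where "G s = {t \<in> space M. (\<Inter>n\<in>D s. snd (P n (e s))) \<noteq> {} \<and> (\<forall>n\<in>D s. t \<in> fst (P n (e s)))}" for s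
  have finD: "finite (D s)" for s by (auto simp: D_def)
  have G: "G s \<in> sets M" for s
  proof -
    have "{t \<in> space M. t \<in> fst (P n (e s))} = fst (P n (e s))" for n
      using sets.sets_into_space[OF P(1)] by blast
    then have "{t \<in> space M. \<forall>n\<in>D s. t \<in> fst (P n (e s))} \<in> sets M"
      using P(1) by (intro sets.sets_Collect_finite_All finD) simp
    then show ?thesis by (cases "(\<Inter>n\<in>D s. snd (P n (e s))) = {}") (auto simp: G_def)
  qed
  have SG: "S s \<subseteq> G s" for s
  proof
    fix t assume "t \<in> S s"
    then obtain x z where z: "z \<in> cyl s" "\<And>n. t \<in> fst (P n z)" "\<And>n. x \<in> snd (P n z)"
      by (auto simp: S_def)
    have "P n (e s) = P n z" if "n \<in> D s" for n
      using that e z(1) unfolding D_def by blast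
    moreover from this z(3) have "x \<in> (\<Inter>n\<in>D s. snd (P n (e s)))" by auto
    moreover have "t \<in> space M" using z(2)[of 0] sets.sets_into_space[OF P(1)] by blast
    ultimately show "t \<in> G s"
      unfolding G_def using z(2) by auto
  qed
  have "\<exists>H. H \<in> sets M \<and> S s \<subseteq> H \<and> H \<subseteq> G s \<and>
      (\<forall>F. F \<in> sets M \<longrightarrow> F \<subseteq> H - S s \<longrightarrow> F \<in> null_sets M)" for s
    using measurable_hull_subset[OF fin SG G, of s] by metis
  then obtain H where H: "\<And>s. H s \<in> sets M" "\<And>s. S s \<subseteq> H s" "\<And>s. H s \<subseteq> G s"
    and Hnull: "\<And>s F. F \<in> sets M \<Longrightarrow> F \<subseteq> H s - S s \<Longrightarrow> F \<in> null_sets M"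
    by metis
  \<comment> \<open>The points in the hull of some node but in the hull of none of its children.
    This set is null, since the sets \<open>S (s @ [j])\<close> cover \<open>S s\<close> and there
    are only countably many finite sequences.\<close>
  define N where "N = (\<Union>s. H s - (\<Union>j. H (s @ [j])))"
  have Sstep: "S s \<subseteq> (\<Union>j. S (s @ [j]))" for s
  proof
    fix t assume "t \<in> S s"
    then obtain x z where z: "z \<in> cyl s" "\<And>n. t \<in> fst (P n z)" "\<And>n. x \<in> snd (P n z)"
      by (auto simp: S_def)
    then have "z \<in> cyl (s @ [z (length s)])" by (auto simp: cyl_def)
    with z(2,3) show "t \<in> (\<Union>j. S (s @ [j]))" unfolding S_def by blast
  qed
  have N: "N \<in> null_sets M"
    unfolding N_def
  proof (intro null_sets_UN' Hnull)
    fix s show "H s - (\<Union>j. H (s @ [j])) \<subseteq> H s - S s"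
      using Sstep[of s] H(2) by blast
  qed (use H(1) in auto)
  have "t \<in> S []" if t: "t \<in> H []" "t \<notin> N" for t
  proof -
    \<comment> \<open>Off \<open>N\<close> every node whose hull contains \<open>t\<close> has a
      child with this property, so greedy choice descends along an infinite branch.\<close>
    define g where "g = rec_nat [] (\<lambda>_ s. s @ [SOME j. t \<in> H (s @ [j])])"
    define z where "z k = (SOME j. t \<in> H (g k @ [j]))" for k
    have g: "g k = map z [0..<k]" for k
      by (induction k) (auto simp: g_def z_def)
    have tg: "t \<in> H (g k)" for k
    proof (induction k)
      case 0
      then show ?case using t by (simp add: g_def)
    next
      case (Suc k)
      then have "\<exists>j. t \<in> H (g k @ [j])" using t(2) unfolding N_def by blast
      then have "t \<in> H (g k @ [z k])" unfolding z_def by (rule someI_ex)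
      then show ?case by (simp add: g)
    qed
    have zc: "z \<in> cyl (g k)" for k by (auto simp: cyl_def g)
    \<comment> \<open>A finite prefix of \<open>z\<close> decides rectangle \<open>n\<close>, so
      every index eventually enters \<open>D (g k)\<close>.\<close>
    have ev: "\<exists>K. \<forall>k\<ge>K. n \<in> D (g k)" for n
    proof -
      obtain B where B: "\<And>z'. (\<forall>i<B. z' i = z i) \<Longrightarrow> P n z' = P n z"
        using P(3)[of n] unfolding locally_constant_def by meson
      have "P n z' = P n z" if "z' \<in> cyl (g k)" "k \<ge> B" for z' k
        using that by (intro B) (auto simp: cyl_def g)
      then show ?thesis
        by (intro exI[of _ "max B (Suc n)"]) (auto simp: D_def g)
    qed
    have Pe: "P n (e (g k)) = P n z" if "n \<in> D (g k)" for n k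
      using that e zc unfolding D_def by blast
    have tG: "t \<in> G (g k)" for k using tg H(3) by blast
    have t1: "t \<in> fst (P n z)" for n
      using ev[of n] tG Pe[of n] unfolding G_def by fastforce
    have "(\<Inter>n\<in>UNIV. snd (P n z)) \<noteq> {}"
    proof -
      \<comment> \<open>The compact set of index 0 is the ambient space for the finite intersection
        property. Finitely many indices are decided at one common level \<open>k\<close>, where
        \<open>t \<in> G (g k)\<close> supplies the common point.\<close>
      have "snd (P 0 z) \<inter> (\<Inter>n\<in>UNIV. snd (P n z)) \<noteq> {}"
      proof (rule compact_imp_fip_image)
        fix I :: "nat set" assume "finite I" "I \<subseteq> UNIV"
        obtain K where K: "\<And>n k. k \<ge> K n \<Longrightarrow> n \<in> D (g k)" using ev by metis
        define k where "k = Max (K ` insert 0 I)"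
        have I: "n \<in> D (g k)" if "n \<in> insert 0 I" for n
          using that \<open>finite I\<close> unfolding k_def by (intro K Max_ge) auto
        obtain x where "\<And>n. n \<in> D (g k) \<Longrightarrow> x \<in> snd (P n (e (g k)))"
          using tG[of k] unfolding G_def by auto
        then have "x \<in> snd (P n z)" if "n \<in> insert 0 I" for n
          using I[OF that] Pe[of n k] by metis
        then show "snd (P 0 z) \<inter> (\<Inter>n\<in>I. snd (P n z)) \<noteq> {}" by auto
      qed (simp_all add: P(2) compact_imp_closed)
      then show ?thesis by (rule contrapos_nn) simp
    qed
    then obtain x where "\<And>n. x \<in> snd (P n z)" by blast
    moreover have "z \<in> cyl []" by (simp add: cyl_def)
    ultimately show ?thesis unfolding S_def using t1 by blast
  qed
  \<comment> \<open>The projection differs from the measurable set \<open>H [] - N\<close> only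
    inside \<open>N\<close>; completeness makes that remainder measurable.\<close>
  then have "S [] = (H [] - N) \<union> (S [] \<inter> N)" using H(2)[of "[]"] by blast
  moreover have "S [] \<inter> N \<in> null_sets M" using N by (rule complete2[rotated]) auto
  ultimately have "S [] \<in> sets M"
    using H(1)[of "[]"] N by (metis null_setsD2 sets.Diff sets.Un)
  moreover have "fst ` E = S []"
  proof -
    have "(t, x) \<in> E \<longleftrightarrow> (\<exists>z\<in>cyl []. \<forall>n. t \<in> fst (P n z) \<and> x \<in> snd (P n z))" for t x
      by (simp add: EP souslin_set_def cyl_def)
    then show ?thesis unfolding S_def by force
  qed
  ultimately show ?thesis by simp
qed

section \<open>Measurable minimizers\<close>

lemma argmin_compact_nonempty:
  fixes f :: "'b::euclidean_space \<Rightarrow> real"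
  assumes "closed S" "S \<noteq> {}" "continuous_on UNIV f" "\<And>c. bounded {z. f z \<le> c}"
  shows "compact {z \<in> S. \<forall>z'\<in>S. f z \<le> f z'}" "{z \<in> S. \<forall>z'\<in>S. f z \<le> f z'} \<noteq> {}"
proof -
  have cl: "closed {z. f z \<le> c}" for c
    using assms(3) by (intro closed_Collect_le continuous_on_const)
  from assms(2) obtain z0 where z0: "z0 \<in> S" by blast
  have comp: "compact (S \<inter> {z. f z \<le> f z0})"
    using assms cl by (intro closed_Int_compact) (auto simp: compact_eq_bounded_closed)
  have "{z \<in> S. \<forall>z'\<in>S. f z \<le> f z'} = (\<Inter>z'\<in>S. {z. f z \<le> f z'}) \<inter> (S \<inter> {z. f z \<le> f z0})"
    using z0 by auto
  moreover have "closed (\<Inter>z'\<in>S. {z. f z \<le> f z'})" using cl by auto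
  ultimately show "compact {z \<in> S. \<forall>z'\<in>S. f z \<le> f z'}"
    using comp by (simp add: closed_Int_compact)
  have "continuous_on (S \<inter> {z. f z \<le> f z0}) f"
    using assms(3) continuous_on_subset by blast
  then obtain z where z: "z \<in> S" "f z \<le> f z0" "\<And>z'. z' \<in> S \<Longrightarrow> f z' \<le> f z0 \<Longrightarrow> f z \<le> f z'"
    using continuous_attains_inf[OF comp, of f] z0 by auto
  then have "f z \<le> f z'" if "z' \<in> S" for z'
    using that by (cases "f z' \<le> f z0") auto
  with z(1) show "{z \<in> S. \<forall>z'\<in>S. f z \<le> f z'} \<noteq> {}" by blast
qed

section \<open>Minimization in each section of a measurable set\<close>

definition argmin_graph :: "('a \<times> 'b) set \<Rightarrow> ('a \<times> 'b \<Rightarrow> real) \<Rightarrow> ('a \<times> 'b) set" where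
  "argmin_graph E f = {w \<in> E. \<forall>w'\<in>E. fst w' = fst w \<longrightarrow> f w \<le> f w'}"

lemma argmin_graph_section:
  "{z. (t, z) \<in> argmin_graph E f} =
     {z \<in> {z. (t, z) \<in> E}. \<forall>z'\<in>{z. (t, z) \<in> E}. f (t, z) \<le> f (t, z')}"
  by (auto simp: argmin_graph_def)

text \<open>A point fails to be minimal exactly when a rational \<open>c\<close> lies strictly
  between its value and a smaller one in its section. For fixed \<open>c\<close> the sections with a
  value below \<open>c\<close> form a projection, hence a measurable set.\<close>

lemma argmin_graph_measurable:
  fixes E :: "('a \<times> 'b::euclidean_space) set" and f :: "'a \<times> 'b \<Rightarrow> real"
  assumes "finite_measure M" "complete_measure M" and E: "E \<in> sets (M \<Otimes>\<^sub>M borel)"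
    and f: "f \<in> borel_measurable (M \<Otimes>\<^sub>M borel)"
  shows "argmin_graph E f \<in> sets (M \<Otimes>\<^sub>M borel)"
proof -
  have E_sub: "E \<subseteq> space (M \<Otimes>\<^sub>M borel)" using sets.sets_into_space[OF E] .
  have lt: "{w \<in> E. f w < c} \<in> sets (M \<Otimes>\<^sub>M borel)" for c
  proof -
    have "{w \<in> E. f w < c} = E \<inter> {w \<in> space (M \<Otimes>\<^sub>M borel). f w < c}" using E_sub by blast
    then show ?thesis using E f by simp
  qed
  have gt: "{w \<in> E. f w > c} \<in> sets (M \<Otimes>\<^sub>M borel)" for c
  proof -
    have "{w \<in> E. f w > c} = E \<inter> {w \<in> space (M \<Otimes>\<^sub>M borel). f w > c}" using E_sub by blast
    then show ?thesis using E f by simp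
  qed
  let ?B = "\<lambda>c. (fst ` {w \<in> E. f w < c} \<times> UNIV) \<inter> {w \<in> E. f w > c}"
  have "argmin_graph E f = E - (\<Union>c\<in>\<rat>. ?B c)"
  proof (intro set_eqI iffI)
    fix w assume "w \<in> argmin_graph E f"
    then show "w \<in> E - (\<Union>c\<in>\<rat>. ?B c)" by (force simp: argmin_graph_def)
  next
    fix w assume w: "w \<in> E - (\<Union>c\<in>\<rat>. ?B c)"
    have "f w \<le> f w'" if "w' \<in> E" "fst w' = fst w" for w'
    proof (rule ccontr)
      assume "\<not> f w \<le> f w'"
      then obtain c where c: "c \<in> \<rat>" "f w' < c" "c < f w" using Rats_dense_in_real[of "f w'" "f w"] by auto
      with that have "fst w \<in> fst ` {w \<in> E. f w < c}" by (metis (mono_tags, lifting) imageI mem_Collect_eq)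
      with c w have "w \<in> ?B c" by (auto simp: mem_Times_iff)
      with c w show False by blast
    qed
    with w show "w \<in> argmin_graph E f" by (auto simp: argmin_graph_def)
  qed
  moreover have "?B c \<in> sets (M \<Otimes>\<^sub>M borel)" for c
    using measurable_projection[OF assms(1,2) lt, of c] gt by auto
  then have "(\<Union>c\<in>\<rat>. ?B c) \<in> sets (M \<Otimes>\<^sub>M borel)"
    by (rule sets.countable_UN''[OF countable_rat])
  ultimately show ?thesis using E by simp
qed

text \<open>The minimizers of \<open>f\<close> are refined by successively minimizing the distance to the points of a
  dense sequence. This leaves exactly one point in every section, and a function with measurable
  graph is measurable by projection.\<close>

proposition measurable_minimizer:
  fixes E :: "('a \<times> 'b::euclidean_space) set" and f :: "'a \<times> 'b \<Rightarrow> real"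
  assumes fin: "finite_measure M" and compl: "complete_measure M"
    and E: "E \<in> sets (M \<Otimes>\<^sub>M borel)" and f: "f \<in> borel_measurable (M \<Otimes>\<^sub>M borel)"
    and closed: "\<And>t. t \<in> space M \<Longrightarrow> closed {z. (t, z) \<in> E}"
    and cont: "\<And>t. t \<in> space M \<Longrightarrow> continuous_on UNIV (\<lambda>z. f (t, z))"
    and coercive: "\<And>t c. t \<in> space M \<Longrightarrow> bounded {z. f (t, z) \<le> c}"
  obtains g where "g \<in> borel_measurable M"
    "\<And>t z. (t, z) \<in> E \<Longrightarrow> (t, g t) \<in> E \<and> f (t, g t) \<le> f (t, z)"
proof -
  obtain Q :: "'b set" where Q: "countable Q" "\<And>X. open X \<Longrightarrow> X \<noteq> {} \<Longrightarrow> \<exists>d\<in>Q. d \<in> X"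
    using countable_dense_setE by blast
  have Qne: "Q \<noteq> {}" using Q(2)[of UNIV] by auto
  define q where "q = from_nat_into Q"
  define D where "D = rec_nat (argmin_graph E f) (\<lambda>k A. argmin_graph A (\<lambda>w. dist (snd w) (q k)))"
  have D_0: "D 0 = argmin_graph E f"
    and D_Suc: "D (Suc k) = argmin_graph (D k) (\<lambda>w. dist (snd w) (q k))" for k
    by (simp_all add: D_def)
  have D_meas: "D k \<in> sets (M \<Otimes>\<^sub>M borel)" for k
  proof (induction k)
    case 0
    then show ?case unfolding D_0 by (intro argmin_graph_measurable fin compl E f)
  next
    case (Suc k)
    then show ?case unfolding D_Suc
      by (intro argmin_graph_measurable fin compl Suc borel_measurable_dist measurable_snd) simp
  qed
  have D_dec: "D (Suc k) \<subseteq> D k" for k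
    by (auto simp: D_Suc argmin_graph_def)
  have D_E: "D k \<subseteq> E" for k
    by (induction k) (use D_dec in \<open>auto simp: D_0 argmin_graph_def\<close>)
  have D_sec: "compact {z. (t, z) \<in> D k} \<and> {z. (t, z) \<in> D k} \<noteq> {}" if t: "t \<in> fst ` E" for t k
  proof -
    from t have tM: "t \<in> space M" using sets.sets_into_space[OF E] by (auto simp: space_pair_measure)
    show ?thesis
    proof (induction k)
      case 0
      show ?case
        unfolding D_0 argmin_graph_section
        using argmin_compact_nonempty[OF closed[OF tM] _ cont[OF tM] coercive[OF tM]] t by force
    next
      case (Suc k)
      have "bounded {z. dist z (q k) \<le> c}" for c
        using bounded_cball[of "q k" c] by (simp add: cball_def dist_commute)
      moreover have "continuous_on UNIV (\<lambda>z. dist z (q k))" by (intro continuous_intros)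
      ultimately show ?case
        using Suc unfolding D_Suc argmin_graph_section
        using argmin_compact_nonempty[of "{z. (t, z) \<in> D k}" "\<lambda>z. dist z (q k)"]
        by (simp only: snd_conv compact_imp_closed) blast
    qed
  qed
  define I where "I = (\<Inter>k. D k)"
  have I: "I \<in> sets (M \<Otimes>\<^sub>M borel)" unfolding I_def using D_meas by auto
  have ex: "\<exists>z. (t, z) \<in> I" if t: "t \<in> fst ` E" for t
  proof -
    have "\<Inter>(range (\<lambda>k. {z. (t, z) \<in> D k})) \<noteq> {}"
    proof (rule compact_nest)
      fix m n :: nat assume "m \<le> n"
      then have "D n \<subseteq> D m" using lift_Suc_antimono_le[of D, OF D_dec] by blast
      then show "{z. (t, z) \<in> D n} \<subseteq> {z. (t, z) \<in> D m}" by blast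
    qed (use D_sec[OF t] in auto)
    then show ?thesis by (auto simp: I_def)
  qed
  have uniq: "z = z'" if z: "(t, z) \<in> I" "(t, z') \<in> I" for t z z'
  proof (rule ccontr)
    assume "z \<noteq> z'"
    \<comment> \<open>Points surviving stage \<open>Suc k\<close> are equidistant from
      \<open>q k\<close>. A dense point \<open>d\<close> within half of \<open>dist z z'\<close>
      from \<open>z\<close> would then be as close to \<open>z'\<close>, against the triangle
      inequality.\<close>
    then obtain d where d: "d \<in> Q" "d \<in> ball z (dist z z' / 2)"
      using Q(2)[of "ball z (dist z z' / 2)"] by auto
    obtain k where k: "q k = d" using d(1) Q(1) from_nat_into_surj unfolding q_def by metis
    have "(t, z) \<in> D (Suc k)" "(t, z') \<in> D (Suc k)" using z by (auto simp: I_def)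
    then have "dist z d = dist z' d" by (force simp: D_Suc argmin_graph_def k)
    then show False using d(2) dist_triangle[of z z' d] by (simp add: dist_commute)
  qed
  \<comment> \<open>The value 0 off the projection is arbitrary; it accounts for the second set in
    the preimage below.\<close>
  define g where "g t = (if t \<in> fst ` E then THE z. (t, z) \<in> I else 0)" for t
  have gI: "(t, g t) \<in> I" if "t \<in> fst ` E" for t
    using ex[OF that] uniq that unfolding g_def by (auto intro: theI)
  have g_meas: "g \<in> borel_measurable M"
  proof (rule measurableI)
    fix B :: "'b set" assume B: "B \<in> sets borel"
    have "g -` B \<inter> space M =
        fst ` (I \<inter> (space M \<times> B)) \<union> (if 0 \<in> B then space M - fst ` E else {})" (is "?L = ?R")
    proof (intro set_eqI iffI)
      fix t assume t: "t \<in> ?L"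
      show "t \<in> ?R"
      proof (cases "t \<in> fst ` E")
        case True
        with gI[OF True] t have "(t, g t) \<in> I \<inter> (space M \<times> B)" by auto
        then have "t \<in> fst ` (I \<inter> (space M \<times> B))" by force
        then show ?thesis by simp
      qed (use t in \<open>auto simp: g_def\<close>)
    next
      fix t assume "t \<in> ?R"
      then consider z where "(t, z) \<in> I" "z \<in> B" "t \<in> space M" | "0 \<in> B" "t \<in> space M" "t \<notin> fst ` E"
        by (auto split: if_splits)
      then show "t \<in> ?L"
      proof cases
        case 1
        then have "t \<in> fst ` E" using D_E unfolding I_def by force
        with gI uniq 1 have "g t = z" by blast
        with 1 show ?thesis by simp
      qed (simp add: g_def)
    qed
    moreover have "fst ` (I \<inter> (space M \<times> B)) \<in> sets M" "fst ` E \<in> sets M"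
      using I B E by (auto intro!: measurable_projection[OF fin compl])
    ultimately show "g -` B \<inter> space M \<in> sets M" by auto
  qed simp
  have "(t, g t) \<in> E \<and> f (t, g t) \<le> f (t, z)" if "(t, z) \<in> E" for t z
  proof -
    have "t \<in> fst ` E" using that by force
    then have "(t, g t) \<in> D 0" using gI by (auto simp: I_def)
    then show ?thesis using that by (auto simp: D_0 argmin_graph_def)
  qed
  with g_meas show ?thesis using that by blast
qed

section \<open>Regular normals at minimizers\<close>

lemma regular_normal_cone_subset_limiting: "regular_normal_cone z \<Omega> \<subseteq> limiting_normal_cone z \<Omega>"
proof
  fix zs assume "zs \<in> regular_normal_cone z \<Omega>"
  then show "zs \<in> limiting_normal_cone z \<Omega>"
    unfolding limiting_normal_cone_def
    by (intro CollectI exI[of _ "\<lambda>_. z"] exI[of _ "\<lambda>_. zs"]) auto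
qed

text \<open>Fermat's rule: minimality turns the first-order expansion of \<open>f\<close> into
  \<open>- inner g (w - z) \<le> e * norm (w - z)\<close> for \<open>w\<close> in \<open>C\<close>
  near \<open>z\<close>, for every \<open>e > 0\<close>.\<close>

lemma neg_gradient_regular_normal:
  fixes f :: "'z::euclidean_space \<Rightarrow> real"
  assumes der: "(f has_derivative (\<lambda>h. inner g h)) (at z)"
    and z: "z \<in> C" "\<And>w. w \<in> C \<Longrightarrow> f z \<le> f w"
  shows "- g \<in> regular_normal_cone z C"
proof -
  have "Limsup (at z within C) (\<lambda>w. ereal (inner (- g) (w - z) / norm (w - z))) \<le> 0"
  proof (rule ereal_le_epsilon2)
    fix e :: real assume e: "0 < e"
    obtain d where d: "d > 0" "\<And>w. norm (w - z) < d \<Longrightarrow> norm (f w - f z - inner g (w - z)) \<le> e * norm (w - z)"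
      using der e unfolding has_derivative_at_alt by blast
    have "eventually (\<lambda>w. ereal (inner (- g) (w - z) / norm (w - z)) \<le> ereal e) (at z within C)"
      unfolding eventually_at
    proof (intro exI[of _ d] conjI ballI impI d(1))
      fix w assume w: "w \<in> C" "w \<noteq> z \<and> dist w z < d"
      have "- inner g (w - z) \<le> e * norm (w - z)"
        using d(2)[of w] w z(2)[OF w(1)] by (auto simp: dist_norm)
      then show "ereal (inner (- g) (w - z) / norm (w - z)) \<le> ereal e"
        using w by (simp add: divide_simps)
    qed
    then show "Limsup (at z within C) (\<lambda>w. ereal (inner (- g) (w - z) / norm (w - z))) \<le> 0 + ereal e"
      by (simp add: Limsup_bounded)
  qed
  then show ?thesis using z(1) by (simp add: regular_normal_cone_def)
qed

section \<open>The smoothed penalty and its gradient\<close>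

text \<open>Smoothing the second norm keeps the penalty differentiable at \<open>y = u\<close>, so that no
  subdifferential sum rule is needed.\<close>

definition penalty :: "'x::euclidean_space \<Rightarrow> 'y::euclidean_space \<Rightarrow> real \<Rightarrow> real \<Rightarrow> 'x \<times> 'y \<Rightarrow> real" where
  "penalty x1 u L d z = norm (fst z - x1) + sqrt (inner (snd z - u) (snd z - u) + d\<^sup>2) / L"

text \<open>The \<open>y\<close>-component of the gradient of the penalty. It is not negated:
  \<open>coderivative\<close> already pairs \<open>xs\<close> with \<open>- ys\<close>, and the
  normal used is the negative gradient.\<close>

definition penalty_dual :: "'y::euclidean_space \<Rightarrow> real \<Rightarrow> real \<Rightarrow> 'y \<Rightarrow> 'y" where
  "penalty_dual u L d y = (1 / (L * sqrt (inner (y - u) (y - u) + d\<^sup>2))) *\<^sub>R (y - u)"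

lemma norm_le_smoothed_norm: "norm v \<le> sqrt (inner v v + d\<^sup>2)"
  by (simp add: norm_eq_sqrt_inner)

lemma penalty_bounds:
  assumes "L > 0"
  shows "norm (fst z - x1) \<le> penalty x1 u L d z" "norm (snd z - u) \<le> L * penalty x1 u L d z"
proof -
  have 1: "norm (snd z - u) / L \<le> sqrt (inner (snd z - u) (snd z - u) + d\<^sup>2) / L"
    using assms norm_le_smoothed_norm by (intro divide_right_mono) auto
  have "0 \<le> norm (snd z - u) / L" using assms by simp
  with 1 show "norm (fst z - x1) \<le> penalty x1 u L d z" unfolding penalty_def by linarith
  have "norm (snd z - u) / L \<le> penalty x1 u L d z"
    using 1 norm_ge_zero[of "fst z - x1"] unfolding penalty_def by linarith
  then show "norm (snd z - u) \<le> L * penalty x1 u L d z"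
    using assms by (simp add: field_simps)
qed

lemma penalty_bounded_sublevel:
  assumes "L > 0"
  shows "bounded {z. penalty x1 u L d z \<le> c}"
proof (rule bounded_subset)
  show "bounded (cball x1 c \<times> cball u (L * c))" by (intro bounded_Times bounded_cball)
  show "{z. penalty x1 u L d z \<le> c} \<subseteq> cball x1 c \<times> cball u (L * c)"
  proof
    fix z assume "z \<in> {z. penalty x1 u L d z \<le> c}"
    then have c: "penalty x1 u L d z \<le> c" by simp
    then have "L * penalty x1 u L d z \<le> L * c" using assms by simp
    with c penalty_bounds[OF assms, where z = z and ?x1.0 = x1 and u = u and d = d] have "norm (fst z - x1) \<le> c" "norm (snd z - u) \<le> L * c"
      by linarith+
    then show "z \<in> cball x1 c \<times> cball u (L * c)"
      by (simp add: mem_Times_iff dist_norm norm_minus_commute)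
  qed
qed

lemma penalty_continuous: "continuous_on UNIV (penalty x1 u L d)"
  unfolding penalty_def divide_inverse by (intro continuous_intros)

lemma norm_penalty_dual_le:
  assumes "L > 0"
  shows "norm (penalty_dual u L d y) \<le> 1 / L"
proof -
  define s where "s = sqrt (inner (y - u) (y - u) + d\<^sup>2)"
  have "norm (y - u) \<le> s" "0 \<le> s"
    unfolding s_def using norm_le_smoothed_norm by auto
  then have "norm (y - u) / (L * s) \<le> 1 / L"
    using assms by (cases "s = 0") (simp_all add: divide_simps)
  then show ?thesis
    using assms \<open>0 \<le> s\<close> unfolding penalty_dual_def s_def[symmetric] by (simp add: abs_mult)
qed

text \<open>\<open>xh \<noteq> x1\<close> keeps the first norm differentiable, and
  \<open>d \<noteq> 0\<close> keeps the argument of the square root positive.\<close>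

lemma penalty_has_derivative:
  assumes "xh \<noteq> x1" "d \<noteq> 0"
  shows "(penalty x1 u L d has_derivative
    (\<lambda>h. inner (sgn (xh - x1), penalty_dual u L d yh) h)) (at (xh, yh))"
proof -
  let ?s = "sqrt (inner (yh - u) (yh - u) + d\<^sup>2)"
  have pos: "inner (yh - u) (yh - u) + d\<^sup>2 > 0"
    using assms(2) by (simp add: add_nonneg_pos)
  have 0: "((\<lambda>z. fst z - x1) has_derivative fst) (at (xh, yh))"
    by (auto intro!: derivative_eq_intros)
  have 1: "((\<lambda>z. norm (fst z - x1)) has_derivative (\<lambda>h. inner (sgn (xh - x1)) (fst h))) (at (xh, yh))"
    using has_derivative_compose[OF 0, of norm "\<lambda>h. inner h (sgn (xh - x1))"]
      has_derivative_norm[of "xh - x1"] assms(1) by (simp add: inner_commute)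
  have 2: "((\<lambda>z. sqrt (inner (snd z - u) (snd z - u) + d\<^sup>2)) has_derivative
      (\<lambda>h. inner (yh - u) (snd h) / ?s)) (at (xh, yh))"
    using pos
    by (auto intro!: derivative_eq_intros simp: inner_commute field_simps)
  have "((\<lambda>z. norm (fst z - x1) + sqrt (inner (snd z - u) (snd z - u) + d\<^sup>2) / L) has_derivative
      (\<lambda>h. inner (sgn (xh - x1)) (fst h) + (inner (yh - u) (snd h) / ?s) / L)) (at (xh, yh))"
    using has_derivative_add[OF 1 has_derivative_mult_right[OF 2, of "1 / L"]] by (simp add: mult.commute[of L])
  then show ?thesis
    unfolding penalty_def penalty_dual_def by (simp add: inner_prod_def mult.commute[of L])
qed

text \<open>At a minimizer off the target the negative gradient would be a normal whose first component
  has norm one and whose second component has norm at most \<open>1 / L < 1 / l\<close>.\<close>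

lemma penalty_minimizer_on_target:
  fixes G :: "'x::euclidean_space \<Rightarrow> 'y::euclidean_space set"
  assumes "L > \<bar>l\<bar>" "d \<noteq> 0" "yh \<in> G xh"
    and min: "\<And>x y. y \<in> G x \<Longrightarrow> penalty x1 u L d (xh, yh) \<le> penalty x1 u L d (x, y)"
    and cod: "(SUP xs\<in>coderivative G xh yh (penalty_dual u L d yh). ereal (norm xs))
      \<le> ereal (l * norm (penalty_dual u L d yh))"
  shows "xh = x1"
proof (rule ccontr)
  assume ne: "xh \<noteq> x1"
  have L: "L > 0" using assms(1) by linarith
  have "- (sgn (xh - x1), penalty_dual u L d yh) \<in> regular_normal_cone (xh, yh) (gph G)"
    using assms(3) min
    by (intro neg_gradient_regular_normal[OF penalty_has_derivative[OF ne assms(2)]])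
       (auto simp: gph_def)
  then have "- sgn (xh - x1) \<in> coderivative G xh yh (penalty_dual u L d yh)"
    using regular_normal_cone_subset_limiting unfolding coderivative_def by fastforce
  then have "ereal (norm (- sgn (xh - x1))) \<le> ereal (l * norm (penalty_dual u L d yh))"
    using cod by (meson SUP_upper order_trans)
  then have "1 \<le> l * norm (penalty_dual u L d yh)" using ne by (simp add: norm_sgn)
  also have "\<dots> \<le> \<bar>l\<bar> * (1 / L)"
    using norm_penalty_dual_le[OF L] by (intro mult_mono) auto
  also have "\<dots> < 1" using assms(1) L by simp
  finally show False by simp
qed

section \<open>Lipschitzian selections\<close>

lemma penalty_measurable:
  fixes u :: "'a \<Rightarrow> 'y::euclidean_space" and l :: "'a \<Rightarrow> real" and x1 :: "'x::euclidean_space"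
  assumes [measurable]: "u \<in> borel_measurable M" "l \<in> borel_measurable M"
  shows "(\<lambda>w. penalty x1 (u (fst w)) (l (fst w)) d (snd w)) \<in> borel_measurable (M \<Otimes>\<^sub>M borel)"
proof -
  have [measurable]: "(\<lambda>w. fst (snd w :: 'x \<times> 'y)) \<in> borel_measurable (M \<Otimes>\<^sub>M borel)"
    "(\<lambda>w. snd (snd w :: 'x \<times> 'y)) \<in> borel_measurable (M \<Otimes>\<^sub>M borel)"
    by (intro measurable_compose[OF measurable_snd] borel_measurable_continuous_onI continuous_intros)+
  show ?thesis unfolding penalty_def by measurable
qed

text \<open>\<open>near_x\<close> and \<open>near_y\<close> are the budget for applying
  \<open>quasi\<close> to the minimizers, which lie within \<open>2 * norm (x0 - x1)\<close> of
  \<open>x1\<close> and \<open>norm (x0 - x1) * (\<bar>l t\<bar> + 2)\<close> of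
  \<open>u t\<close>.\<close>

lemma lipschitz_selection:
  fixes \<Phi> :: "'a \<Rightarrow> 'x::euclidean_space \<Rightarrow> 'y::euclidean_space set"
  assumes fin: "finite_measure M" and compl: "complete_measure M" and normal: "normal_integrand M \<Phi>"
    and l: "integrable M l"
    and quasi: "\<And>x y ys. in_Linf M x \<Longrightarrow> Linf_norm M (\<lambda>t. x t - xbar) \<le> ereal \<eta> \<Longrightarrow>
          integrable M y \<Longrightarrow> L1_norm M (\<lambda>t. y t - v t) \<le> \<eta> \<Longrightarrow>
          AE t in M. y t \<in> \<Phi> t (x t) \<Longrightarrow> in_Linf M ys \<Longrightarrow>
          AE t in M. (SUP xs\<in>coderivative (\<Phi> t) (x t) (y t) (ys t). ereal (norm xs))
             \<le> ereal (l t * norm (ys t))"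
    and v: "integrable M v" and u: "integrable M u" "AE t in M. u t \<in> \<Phi> t x0"
    and ne: "x0 \<noteq> x1"
    and near_x: "norm (x1 - xbar) + 2 * norm (x0 - x1) \<le> \<eta>"
    and near_y: "L1_norm M (\<lambda>t. u t - v t) + norm (x0 - x1) * (\<integral>t. \<bar>l t\<bar> + 2 \<partial>M) \<le> \<eta>"
  obtains y where "integrable M y" "AE t in M. y t \<in> \<Phi> t x1"
    "AE t in M. norm (y t - u t) \<le> norm (x0 - x1) * (\<bar>l t\<bar> + 2)"
proof -
  interpret finite_measure M by fact
  define d where "d = norm (x0 - x1)"
  have d: "d > 0" using ne by (simp add: d_def)
  \<comment> \<open>Strictly above \<open>\<bar>l t\<bar>\<close>, so that the slope
    \<open>1 / L t\<close> beats the coderivative bound, and at least 1, so that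
    \<open>d / L t \<le> d\<close> and the dual is bounded by 1.\<close>
  define L where "L t = \<bar>l t\<bar> + 1" for t
  have L: "L t > 0" "L t \<ge> 1" for t by (auto simp: L_def)
  have [measurable]: "u \<in> borel_measurable M" "v \<in> borel_measurable M" "l \<in> borel_measurable M"
    using u v l by auto
  have [measurable]: "L \<in> borel_measurable M" unfolding L_def by measurable
  define E where "E = {(t, z). t \<in> space M \<and> z \<in> gph (\<Phi> t)}"
  define f where "f = (\<lambda>w. penalty x1 (u (fst w)) (L (fst w)) d (snd w))"
  have E: "E \<in> sets (M \<Otimes>\<^sub>M borel)" using normal by (simp add: normal_integrand_def E_def)
  have f: "f \<in> borel_measurable (M \<Otimes>\<^sub>M borel)"
    unfolding f_def by (intro penalty_measurable) measurable
  have closed: "closed {z. (t, z) \<in> E}" if "t \<in> space M" for t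
    using that normal by (simp add: normal_integrand_def E_def)
  have cont: "continuous_on UNIV (\<lambda>z. f (t, z))" for t
    by (simp add: f_def penalty_continuous)
  have bdd: "bounded {z. f (t, z) \<le> c}" for t c
    by (simp add: f_def penalty_bounded_sublevel L)
  obtain g where g [measurable]: "g \<in> borel_measurable M"
    and min: "\<And>t z. (t, z) \<in> E \<Longrightarrow> (t, g t) \<in> E \<and> f (t, g t) \<le> f (t, z)"
    using measurable_minimizer[OF fin compl E f closed cont bdd] by blast
  define x where "x t = fst (g t)" for t
  define y where "y t = snd (g t)" for t
  define ys where "ys t = penalty_dual (u t) (L t) d (y t)" for t
  have x_meas [measurable]: "x \<in> borel_measurable M" and y_meas [measurable]: "y \<in> borel_measurable M"
    unfolding x_def y_def
    by (intro measurable_compose[OF g] borel_measurable_continuous_onI continuous_intros)+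
  have ys_meas [measurable]: "ys \<in> borel_measurable M" unfolding ys_def penalty_dual_def by measurable
  have sel: "y t \<in> \<Phi> t (x t) \<and> norm (x t - x1) \<le> 2 * d \<and> norm (y t - u t) \<le> d * (\<bar>l t\<bar> + 2)"
    if t: "t \<in> space M" "u t \<in> \<Phi> t x0" for t
  proof -
    have "(t, (x0, u t)) \<in> E" using t by (simp add: E_def gph_def)
    note m = min[OF this]
    \<comment> \<open>The competitor is \<open>(x0, u t)\<close>: its distance term is
      \<open>d\<close> and its smoothing term is \<open>d / L t\<close>. Using the distance
      \<open>d\<close> itself as smoothing parameter keeps the loss of order
      \<open>d\<close>.\<close>
    have p: "penalty x1 (u t) (L t) d (g t) \<le> d + d / L t"
      using m d by (simp add: f_def penalty_def d_def)
    have "d / L t \<le> d / 1" using d L[of t] by (intro divide_left_mono) auto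
    then have 1: "norm (x t - x1) \<le> 2 * d"
      using p penalty_bounds(1)[OF L(1)[of t], where z = "g t" and ?x1.0 = x1 and u = "u t" and d = d] unfolding x_def by linarith
    have "L t * penalty x1 (u t) (L t) d (g t) \<le> L t * (d + d / L t)"
      using p L(1)[of t] by simp
    also have "\<dots> = d * (\<bar>l t\<bar> + 2)"
      using L(1)[of t] by (simp add: field_simps) (simp add: L_def algebra_simps)
    finally have 2: "norm (y t - u t) \<le> d * (\<bar>l t\<bar> + 2)"
      using penalty_bounds(2)[OF L(1)[of t], where z = "g t" and ?x1.0 = x1 and u = "u t" and d = d] unfolding y_def by linarith
    show ?thesis using 1 2 m by (auto simp: E_def gph_def x_def y_def case_prod_beta)
  qed
  have AE_sel: "AE t in M. y t \<in> \<Phi> t (x t) \<and> norm (x t - x1) \<le> 2 * d \<and> norm (y t - u t) \<le> d * (\<bar>l t\<bar> + 2)"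
    using u(2) AE_space by eventually_elim (use sel in blast)
  have int_bound: "integrable M (\<lambda>t. d * (\<bar>l t\<bar> + 2))" using l by auto
  have y_int: "integrable M y"
  proof (rule Bochner_Integration.integrable_bound)
    show "integrable M (\<lambda>t. norm (u t) + d * (\<bar>l t\<bar> + 2))" using u int_bound by auto
    show "AE t in M. norm (y t) \<le> norm (norm (u t) + d * (\<bar>l t\<bar> + 2))"
      using AE_sel
    proof eventually_elim
      case (elim t)
      then have "norm (y t - u t) \<le> d * (\<bar>l t\<bar> + 2)" by simp
      then show ?case
        using norm_triangle_sub[of "y t" "u t"] abs_ge_self[of "norm (u t) + d * (\<bar>l t\<bar> + 2)"]
        unfolding real_norm_def by linarith
    qed
  qed simp
  \<comment> \<open>The null set granted by \<open>quasi\<close> may depend on the test functions.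
    The duals needed at the individual \<open>t\<close> are therefore gathered beforehand in the one
    bounded measurable function \<open>ys\<close>.\<close>
  have "AE t in M. (SUP xs\<in>coderivative (\<Phi> t) (x t) (y t) (ys t). ereal (norm xs))
      \<le> ereal (l t * norm (ys t))"
  proof (rule quasi)
    have "Linf_norm M x \<le> ereal (norm x1 + 2 * d)"
      unfolding Linf_norm_def
    proof (rule esssup_I)
      show "AE t in M. ereal (norm (x t)) \<le> ereal (norm x1 + 2 * d)"
        using AE_sel
      proof eventually_elim
        case (elim t)
        then show ?case using norm_triangle_sub[of "x t" x1] by simp
      qed
    qed simp
    also have "\<dots> < \<infinity>" by simp
    finally show "in_Linf M x" by (simp add: in_Linf_def)
    show "Linf_norm M (\<lambda>t. x t - xbar) \<le> ereal \<eta>"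
      unfolding Linf_norm_def
    proof (rule esssup_I)
      show "AE t in M. ereal (norm (x t - xbar)) \<le> ereal \<eta>"
        using AE_sel
      proof eventually_elim
        case (elim t)
        then show ?case
          using norm_triangle_ineq[of "x t - x1" "x1 - xbar"] near_x by (simp add: d_def)
      qed
    qed simp
    have "L1_norm M (\<lambda>t. y t - v t) \<le> (\<integral>t. norm (u t - v t) + d * (\<bar>l t\<bar> + 2) \<partial>M)"
      unfolding L1_norm_def
    proof (rule integral_mono_AE)
      show "AE t in M. norm (y t - v t) \<le> norm (u t - v t) + d * (\<bar>l t\<bar> + 2)"
        using AE_sel
      proof eventually_elim
        case (elim t)
        then show ?case using norm_triangle_ineq[of "y t - u t" "u t - v t"] by simp
      qed
    qed (use y_int u v int_bound in auto)
    also have "\<dots> = L1_norm M (\<lambda>t. u t - v t) + d * (\<integral>t. \<bar>l t\<bar> + 2 \<partial>M)"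
    proof -
      have "(\<integral>t. norm (u t - v t) + d * (\<bar>l t\<bar> + 2) \<partial>M) =
          (\<integral>t. norm (u t - v t) \<partial>M) + (\<integral>t. d * (\<bar>l t\<bar> + 2) \<partial>M)"
        using u v int_bound by (intro Bochner_Integration.integral_add) auto
      then show ?thesis by (simp add: L1_norm_def)
    qed
    finally show "L1_norm M (\<lambda>t. y t - v t) \<le> \<eta>" using near_y by (simp add: d_def)
    have "Linf_norm M ys \<le> ereal 1"
      unfolding Linf_norm_def
    proof (rule esssup_I)
      have "norm (ys t) \<le> 1" for t
      proof -
        have "norm (ys t) \<le> 1 / L t" unfolding ys_def by (rule norm_penalty_dual_le[OF L(1)])
        also have "\<dots> \<le> 1" using L[of t] by (simp add: divide_simps)
        finally show ?thesis .
      qed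
      then show "AE t in M. ereal (norm (ys t)) \<le> ereal 1" by simp
    qed simp
    then show "in_Linf M ys" by (auto simp: in_Linf_def)
    show "AE t in M. y t \<in> \<Phi> t (x t)" using AE_sel by eventually_elim simp
  qed (fact y_int)
  then have "AE t in M. x t = x1 \<and> y t \<in> \<Phi> t (x t)"
    using AE_sel AE_space
  proof eventually_elim
    case (elim t)
    have "penalty x1 (u t) (L t) d (x t, y t) \<le> penalty x1 (u t) (L t) d (a, b)" if "b \<in> \<Phi> t a" for a b
      using min[of t "(a, b)"] that elim(3) by (simp add: E_def gph_def f_def x_def y_def)
    moreover have "L t > \<bar>l t\<bar>" by (simp add: L_def)
    ultimately have "x t = x1"
      using penalty_minimizer_on_target[where l = "l t" and L = "L t" and d = d and yh = "y t"
          and G = "\<Phi> t" and xh = "x t" and ?x1.0 = x1 and u = "u t"] elim d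
      by (simp add: ys_def)
    with elim show ?case by simp
  qed
  then have "AE t in M. y t \<in> \<Phi> t x1" by eventually_elim auto
  moreover have "AE t in M. norm (y t - u t) \<le> norm (x0 - x1) * (\<bar>l t\<bar> + 2)"
    using AE_sel by eventually_elim (simp add: d_def)
  ultimately show ?thesis using that y_int by blast
qed

section \<open>Limits of selections\<close>

lemma expected_integral_iff_selections:
  "y \<in> expected_integral M \<Phi> x \<longleftrightarrow> selections M \<Phi> x y \<noteq> {}"
  by (auto simp: expected_integral_def aumann_integral_def selections_def)

text \<open>Convergence in L1 carries the integrals over and yields a subsequence converging almost
  everywhere, along which the closed graphs retain the limit.\<close>

lemma selections_limit:
  fixes \<Phi> :: "'a \<Rightarrow> 'x::euclidean_space \<Rightarrow> 'y::euclidean_space set"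
  assumes normal: "normal_integrand M \<Phi>"
    and X: "X \<longlonglongrightarrow> xbar" and Y: "Y \<longlonglongrightarrow> ybar"
    and V: "\<And>j::nat. V j \<in> selections M \<Phi> (X j) (Y j)" and w: "integrable M w"
    and lim: "(\<lambda>j. L1_norm M (\<lambda>t. V j t - w t)) \<longlonglongrightarrow> 0"
  shows "w \<in> selections M \<Phi> xbar ybar"
proof -
  have V_int: "integrable M (V j)" and V_Y: "(\<integral>t. V j t \<partial>M) = Y j"
    and V_sel: "AE t in M. V j t \<in> \<Phi> t (X j)" for j
    using V[of j] by (auto simp: selections_def)
  have "(\<lambda>j. (\<integral>t. V j t \<partial>M) - (\<integral>t. w t \<partial>M)) \<longlonglongrightarrow> 0"
  proof (rule Lim_null_comparison[OF _ lim])
    have "norm ((\<integral>t. V j t \<partial>M) - (\<integral>t. w t \<partial>M)) \<le> L1_norm M (\<lambda>t. V j t - w t)" for j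
      using integral_norm_bound[of M "\<lambda>t. V j t - w t"] V_int w by (simp add: L1_norm_def)
    then show "\<forall>\<^sub>F j in sequentially. norm ((\<integral>t. V j t \<partial>M) - (\<integral>t. w t \<partial>M)) \<le> L1_norm M (\<lambda>t. V j t - w t)"
      by simp
  qed
  then have "Y \<longlonglongrightarrow> (\<integral>t. w t \<partial>M)" by (simp add: V_Y LIM_zero_iff)
  then have "(\<integral>t. w t \<partial>M) = ybar" using Y LIMSEQ_unique by blast
  moreover have "AE t in M. w t \<in> \<Phi> t xbar"
  proof -
    obtain s :: "nat \<Rightarrow> nat" where s: "strict_mono s" "AE t in M. (\<lambda>n. V (s n) t - w t) \<longlonglongrightarrow> 0"
      using tendsto_L1_AE_subseq[of M "\<lambda>j t. V j t - w t"] V_int w lim by (auto simp: L1_norm_def)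
    have Xs: "(\<lambda>n. X (s n)) \<longlonglongrightarrow> xbar" using LIMSEQ_subseq_LIMSEQ[OF X s(1)] by (simp add: o_def)
    have "AE t in M. \<forall>j. V j t \<in> \<Phi> t (X j)" using V_sel by (simp add: AE_all_countable)
    then show ?thesis
      using s(2) AE_space
    proof eventually_elim
      case (elim t)
      then have lim_t: "(\<lambda>n. (X (s n), V (s n) t)) \<longlonglongrightarrow> (xbar, w t)"
        using Xs by (intro tendsto_Pair) (auto simp: LIM_zero_iff)
      have "closed (gph (\<Phi> t))" using normal elim(3) by (simp add: normal_integrand_def)
      moreover have "\<forall>n. (X (s n), V (s n) t) \<in> gph (\<Phi> t)" using elim(1) by (simp add: gph_def)
      ultimately have "(xbar, w t) \<in> gph (\<Phi> t)"
        using closed_sequentially[of "gph (\<Phi> t)", OF _ _ lim_t] by simp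
      then show ?case by (simp add: gph_def)
    qed
  qed
  ultimately show ?thesis using w by (simp add: selections_def)
qed

section \<open>Sequences violating the Lipschitz-like property\<close>

lemma mem_thickening:
  fixes y y' :: "'y::real_normed_vector"
  assumes "y' \<in> S" "norm (y - y') \<le> c"
  shows "y \<in> {y' + c *\<^sub>R b | y' b. y' \<in> S \<and> b \<in> cball 0 1}"
proof (cases "c = 0")
  case True
  then have "y = y' + c *\<^sub>R 0" using assms(2) by simp
  then show ?thesis using assms(1) by fastforce
next
  case False
  then have "c > 0" using assms(2) norm_ge_zero[of "y - y'"] by linarith
  define b where "b = (1 / c) *\<^sub>R (y - y')"
  have "y = y' + c *\<^sub>R b" "b \<in> cball 0 1"
    using \<open>c > 0\<close> assms(2) by (auto simp: b_def divide_simps)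
  then show ?thesis using assms(1) by blast
qed

text \<open>Stage \<open>k\<close> denies the property with radius \<open>1 / (k + 1)\<close> and
  modulus \<open>k + 1\<close> at once, so the points converge while the modulus outgrows every
  constant.\<close>

lemma not_lipschitz_like_sequences:
  fixes G :: "'x::euclidean_space \<Rightarrow> 'y::euclidean_space set"
  assumes "\<not> lipschitz_like G xbar ybar" "ybar \<in> G xbar"
  obtains X X' Y where "X \<longlonglongrightarrow> xbar" "X' \<longlonglongrightarrow> xbar" "Y \<longlonglongrightarrow> ybar" "\<And>k. Y k \<in> G (X k)"
    "\<And>k y'. y' \<in> G (X' k) \<Longrightarrow> real (Suc k) * norm (X k - X' k) < norm (Y k - y')"
proof -
  have "\<exists>x x' y. x \<in> cball xbar (inverse (real (Suc k))) \<and> x' \<in> cball xbar (inverse (real (Suc k))) \<and>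
      y \<in> cball ybar (inverse (real (Suc k))) \<and> y \<in> G x \<and>
      (\<forall>y'\<in>G x'. real (Suc k) * norm (x - x') < norm (y - y'))" for k
  proof (rule ccontr)
    assume *: "\<not> ?thesis"
    have "G x \<inter> cball ybar (inverse (real (Suc k))) \<subseteq>
        {y' + (real (Suc k) * norm (x - x')) *\<^sub>R b | y' b. y' \<in> G x' \<and> b \<in> cball 0 1}"
      if x: "x \<in> cball xbar (inverse (real (Suc k)))" "x' \<in> cball xbar (inverse (real (Suc k)))" for x x'
    proof
      fix y assume y: "y \<in> G x \<inter> cball ybar (inverse (real (Suc k)))"
      with x * obtain y' where "y' \<in> G x'" "norm (y - y') \<le> real (Suc k) * norm (x - x')"
        by (metis IntD1 IntD2 not_less)
      then show "y \<in> {y' + (real (Suc k) * norm (x - x')) *\<^sub>R b | y' b. y' \<in> G x' \<and> b \<in> cball 0 1}"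
        by (rule mem_thickening)
    qed
    moreover have "(xbar, ybar) \<in> gph G" using assms(2) by (simp add: gph_def)
    moreover have "inverse (real (Suc k)) > 0" "real (Suc k) \<ge> 0" by simp_all
    ultimately have "lipschitz_like G xbar ybar"
      unfolding lipschitz_like_def by blast
    with assms(1) show False by contradiction
  qed
  then obtain X X' Y where
    X: "\<And>k. X k \<in> cball xbar (inverse (real (Suc k)))" and X': "\<And>k. X' k \<in> cball xbar (inverse (real (Suc k)))"
    and Y: "\<And>k. Y k \<in> cball ybar (inverse (real (Suc k)))" "\<And>k. Y k \<in> G (X k)"
    and far: "\<And>k y'. y' \<in> G (X' k) \<Longrightarrow> real (Suc k) * norm (X k - X' k) < norm (Y k - y')"
    by metis
  have lim: "Z \<longlonglongrightarrow> z" if "\<And>k. Z k \<in> cball z (inverse (real (Suc k)))"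
    for Z and z :: "'z::euclidean_space"
  proof -
    have "(\<lambda>k. Z k - z) \<longlonglongrightarrow> 0"
      by (rule Lim_null_comparison[OF _ LIMSEQ_inverse_real_of_nat])
         (use that in \<open>simp add: dist_norm norm_minus_commute\<close>)
    then show ?thesis by (simp add: LIM_zero_iff)
  qed
  show ?thesis
    by (rule that[of X X' Y]) (rule lim[OF X] lim[OF X'] lim[OF Y(1)] Y(2) far, assumption?)+
qed

section \<open>Contradiction along a violating sequence\<close>

theorem proposition5p8:
  fixes M :: "'a measure"
    and \<Phi> :: "'a \<Rightarrow> real ^ 'n \<Rightarrow> (real ^ 'm) set"
    and xbar :: "real ^ 'n"
    and ybar :: "real ^ 'm"
    and Tpa Tna :: "'a set"
  assumes "finite_measure M"
    and "complete_measure M"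
    and "atomic_decomposition M Tpa Tna"
    and "normal_integrand M \<Phi>"
    and "xbar \<in> mdom (expected_integral M \<Phi>)"
    and "\<exists>\<rho>>0. \<exists>\<kappa>. in_L1_pos M \<kappa> \<and>
           (AE t in M. t \<in> Tna \<longrightarrow> (\<forall>x\<in>cball xbar \<rho>. convex (\<Phi> t x))) \<and>
           (AE t in M. \<forall>x\<in>cball xbar \<rho>. \<Phi> t x \<subseteq> cball 0 (\<kappa> t))"
    and "ybar \<in> expected_integral M \<Phi> xbar"
    and "selections_inner_semicompact M \<Phi> xbar ybar"
    and "\<forall>v\<in>selections M \<Phi> xbar ybar. integrably_quasi_lipschitzian M \<Phi> xbar v"
    and "\<forall>v\<in>selections M \<Phi> xbar ybar.
           aumann_integral M (\<lambda>t. coderivative (\<Phi> t) xbar (v t) 0) = {0}"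
  shows "lipschitz_like (expected_integral M \<Phi>) xbar ybar"
proof (rule ccontr)
  assume not_lip: "\<not> lipschitz_like (expected_integral M \<Phi>) xbar ybar"
  obtain X X' Y where X: "X \<longlonglongrightarrow> xbar" and X': "X' \<longlonglongrightarrow> xbar" and Y: "Y \<longlonglongrightarrow> ybar"
    and YE: "\<And>k. Y k \<in> expected_integral M \<Phi> (X k)"
    and far: "\<And>k y'. y' \<in> expected_integral M \<Phi> (X' k)
      \<Longrightarrow> real (Suc k) * norm (X k - X' k) < norm (Y k - y')"
    by (rule not_lipschitz_like_sequences[where G = "expected_integral M \<Phi>", OF not_lip assms(7)])
      (rule that)
  have ne: "selections M \<Phi> (X k) (Y k) \<noteq> {}" for k
    using YE by (simp add: expected_integral_iff_selections)
  obtain V r w where V: "\<And>k. V k \<in> selections M \<Phi> (X k) (Y k)" and r: "strict_mono (r :: nat \<Rightarrow> nat)"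
    and w: "integrable M w" and lim: "(\<lambda>j. L1_norm M (\<lambda>t. V (r j) t - w t)) \<longlonglongrightarrow> 0"
    using assms(8)[unfolded selections_inner_semicompact_def, rule_format, OF tendsto_Pair[OF X Y] ne]
    by (elim exE conjE) (rule that; simp)
  have Xr: "(\<lambda>j. X (r j)) \<longlonglongrightarrow> xbar" and X'r: "(\<lambda>j. X' (r j)) \<longlonglongrightarrow> xbar" and Yr: "(\<lambda>j. Y (r j)) \<longlonglongrightarrow> ybar"
    using LIMSEQ_subseq_LIMSEQ[OF X r] LIMSEQ_subseq_LIMSEQ[OF X' r] LIMSEQ_subseq_LIMSEQ[OF Y r]
    by (simp_all add: o_def)
  \<comment> \<open>The limit has to be a selection at the reference point, because the
    quasi-Lipschitz bound is assumed only around such functions.\<close>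
  have "w \<in> selections M \<Phi> xbar ybar"
    using selections_limit[OF assms(4) Xr Yr V w lim] .
  then have "integrably_quasi_lipschitzian M \<Phi> xbar w" using assms(9) by blast
  then obtain \<eta> l where \<eta>: "\<eta> > 0" and l: "integrable M l"
    and quasi: "\<And>x y ys. in_Linf M x \<Longrightarrow> Linf_norm M (\<lambda>t. x t - xbar) \<le> ereal \<eta> \<Longrightarrow>
          integrable M y \<Longrightarrow> L1_norm M (\<lambda>t. y t - w t) \<le> \<eta> \<Longrightarrow>
          AE t in M. y t \<in> \<Phi> t (x t) \<Longrightarrow> in_Linf M ys \<Longrightarrow>
          AE t in M. (SUP xs\<in>coderivative (\<Phi> t) (x t) (y t) (ys t). ereal (norm xs))
             \<le> ereal (l t * norm (ys t))"
    unfolding integrably_quasi_lipschitzian_def in_L1_pos_def by blast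
  interpret finite_measure M by fact
  \<comment> \<open>Integrating the pointwise bound of \<open>lipschitz_selection\<close> produces
    the factor \<open>C\<close>.\<close>
  define C where "C = (\<integral>t. \<bar>l t\<bar> + 2 \<partial>M)"
  have "(\<lambda>j. norm (X' (r j) - xbar) + 2 * norm (X (r j) - X' (r j))) \<longlonglongrightarrow> norm (xbar - xbar) + 2 * norm (xbar - xbar)"
    by (intro tendsto_intros Xr X'r)
  then have 1: "\<forall>\<^sub>F j in sequentially. norm (X' (r j) - xbar) + 2 * norm (X (r j) - X' (r j)) < \<eta>"
    using \<eta> by (auto dest: order_tendstoD(2))
  have "(\<lambda>j. L1_norm M (\<lambda>t. V (r j) t - w t) + norm (X (r j) - X' (r j)) * C) \<longlonglongrightarrow> 0 + norm (xbar - xbar) * C"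
    by (intro tendsto_intros Xr X'r lim)
  then have 2: "\<forall>\<^sub>F j in sequentially. L1_norm M (\<lambda>t. V (r j) t - w t) + norm (X (r j) - X' (r j)) * C < \<eta>"
    using \<eta> by (auto dest: order_tendstoD(2))
  \<comment> \<open>For \<open>j \<ge> n\<close> the violated modulus \<open>Suc (r j)\<close>
    exceeds \<open>C\<close>, because \<open>j \<le> r j\<close>.\<close>
  obtain n :: nat where n: "C \<le> real n" using real_arch_simple by blast
  have "\<forall>\<^sub>F j in sequentially. norm (X' (r j) - xbar) + 2 * norm (X (r j) - X' (r j)) < \<eta> \<and>
      L1_norm M (\<lambda>t. V (r j) t - w t) + norm (X (r j) - X' (r j)) * C < \<eta> \<and> n \<le> j"
    by (intro eventually_conj 1 2 eventually_ge_at_top)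
  then obtain j where j: "norm (X' (r j) - xbar) + 2 * norm (X (r j) - X' (r j)) < \<eta>"
    "L1_norm M (\<lambda>t. V (r j) t - w t) + norm (X (r j) - X' (r j)) * C < \<eta>" "n \<le> j"
    using eventually_happens'[OF sequentially_bot] by blast
  define d where "d = norm (X (r j) - X' (r j))"
  have C: "C \<le> real (Suc (r j))"
    using n j(3) seq_suble[OF r, of j] by linarith
  \<comment> \<open>If the two points coincided, \<open>Y (r j)\<close> would lie in the value at
    \<open>X' (r j)\<close> and \<open>far\<close> would read \<open>0 < 0\<close>.\<close>
  have ne_j: "X (r j) \<noteq> X' (r j)" using far[of "Y (r j)" "r j"] YE[of "r j"] by auto
  have Vj: "integrable M (V (r j))" "(\<integral>t. V (r j) t \<partial>M) = Y (r j)"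
    and Vj_sel: "AE t in M. V (r j) t \<in> \<Phi> t (X (r j))"
    using V[of "r j"] by (auto simp: selections_def)
  obtain y where y: "integrable M y" "AE t in M. y t \<in> \<Phi> t (X' (r j))"
    and y_near: "AE t in M. norm (y t - V (r j) t) \<le> norm (X (r j) - X' (r j)) * (\<bar>l t\<bar> + 2)"
    by (rule lipschitz_selection[OF assms(1,2,4) l _ w Vj(1) Vj_sel ne_j j(1)[THEN less_imp_le]
          j(2)[THEN less_imp_le, unfolded C_def]])
      ((rule quasi; assumption), (rule that; assumption))
  have "norm (Y (r j) - (\<integral>t. y t \<partial>M)) = norm (\<integral>t. y t - V (r j) t \<partial>M)"
    using y(1) Vj by (simp add: norm_minus_commute)
  also have "\<dots> \<le> (\<integral>t. d * (\<bar>l t\<bar> + 2) \<partial>M)"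
    using y_near y(1) Vj(1) l unfolding d_def
    by (intro order_trans[OF integral_norm_bound] integral_mono_AE) auto
  also have "\<dots> = d * C" by (simp add: C_def)
  also have "\<dots> \<le> real (Suc (r j)) * d"
    unfolding mult.commute[of d C] by (intro mult_right_mono C) (simp add: d_def)
  finally have "norm (Y (r j) - (\<integral>t. y t \<partial>M)) \<le> real (Suc (r j)) * d" .
  moreover have "(\<integral>t. y t \<partial>M) \<in> expected_integral M \<Phi> (X' (r j))"
    using y by (auto simp: expected_integral_iff_selections selections_def)
  ultimately show False using far unfolding d_def by (meson not_le)
qed

end
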